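(* Let $p,q$ be positive integers and consider a $p:q$ homogeneous weight system $$\frac{dx}{dt}=-py^{2p-1}+\sum_{kp+jq>(2p-1)q}a_{kj}x^ky^j,\qquad \frac{dy}{dt}=qx^{2q-1}+\sum_{kp+jq>(2q-1)p}b_{kj}x^ky^j,$$ with return map expansion $\tilde r(2\pi,h)=\sum_{k\ge1}\nu_k(2\pi)h^k$ (defined in the context). If $p$ is an even number and $q$ is an odd number, then the first subscript $k>1$ with $\nu_k(2\pi)\neq0$ (if there is one) is an even number.
   Context: The right-hand sides of the system are real power series in $x,y$ with nonzero radius of convergence. Put $\mathcal X_m(x,y)=\sum_{kp+jq=m}a_{kj}x^ky^j$ and $\mathcal Y_m(x,y)=\sum_{kp+jq=m}b_{kj}x^ky^j$ for the higher-order terms, with the leading terms $\mathcal X_{2pq-q}=-py^{2p-1}$, $\mathcal Y_{2pq-p}=qx^{2q-1}$. The substitution $x=r^p\cos\theta$, $y=r^q\sin\theta$ transforms the system into $$\frac{dr}{d\theta}=r\,\frac{\sum_{k\ge0}R_k(\theta)r^k}{\sum_{k\ge0}Q_k(\theta)r^k},$$ where $R_k(\theta)=\cos\theta\,\mathcal X_{2pq-q+k}(\cos\theta,\sin\theta)+\sin\theta\,\mathcal Y_{2pq-p+k}(\cos\theta,\sin\theta)$ and $Q_k(\theta)=-q\sin\theta\,\mathcal X_{2pq-q+k}(\cos\theta,\sin\theta)+p\cos\theta\,\mathcal Y_{2pq-p+k}(\cos\theta,\sin\theta)$; in particular $Q_0(\theta)=pq(\cos^{2q}\theta+\sin^{2p}\theta)>0$.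 This equation is considered for small $r$ of either sign. For sufficiently small real $h$ (of either sign) let $\tilde r(\theta,h)=\sum_{k\ge1}\nu_k(\theta)h^k$ be its solution with $\tilde r(0,h)=h$; it is a power series in $h$ with nonzero radius of convergence for $|\theta|<4\pi$, with $\nu_1(0)=1$, $\nu_k(0)=0$ for $k\ge2$, and $\nu_1(\theta)=(\cos^{2q}\theta+\sin^{2p}\theta)^{-1/(2pq)}$. *)

theory Defs
  imports "HOL-Analysis.Analysis"
begin

text \<open>
  A weight system is given by its weights \<open>p, q\<close> and the coefficient families
  \<open>a, b\<close> of
  \<open>dx/dt = - p y^(2p-1) + (\<Sum>(k,j) with kp + jq > (2p-1)q. a k j x^k y^j)\<close> and
  \<open>dy/dt = q x^(2q-1) + (\<Sum>(k,j) with kp + jq > (2q-1)p. b k j x^k y^j)\<close>.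
  Values of \<open>a\<close> and \<open>b\<close> outside these index ranges are never used.
\<close>

definition higher_indices :: "nat \<Rightarrow> nat \<Rightarrow> nat \<Rightarrow> (nat \<times> nat) set"
  where "higher_indices p q d = {(k, j). k * p + j * q > d}"

definition convergent_near_0 :: "(nat \<Rightarrow> nat \<Rightarrow> real) \<Rightarrow> (nat \<times> nat) set \<Rightarrow> bool"
  where "convergent_near_0 c I \<longleftrightarrow>
    (\<exists>\<rho>>0. \<forall>x y. \<bar>x\<bar> < \<rho> \<longrightarrow> \<bar>y\<bar> < \<rho> \<longrightarrow>
       (\<lambda>(k, j). c k j * x ^ k * y ^ j) summable_on I)"

definition weight_system ::
    "nat \<Rightarrow> nat \<Rightarrow> (nat \<Rightarrow> nat \<Rightarrow> real) \<Rightarrow> (nat \<Rightarrow> nat \<Rightarrow> real) \<Rightarrow> bool"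
  where "weight_system p q a b \<longleftrightarrow> p > 0 \<and> q > 0 \<and>
     convergent_near_0 a (higher_indices p q ((2 * p - 1) * q)) \<and>
     convergent_near_0 b (higher_indices p q ((2 * q - 1) * p))"

text \<open>The quasi-homogeneous parts of weighted degree \<open>m\<close> of the right-hand sides;
  \<open>2pq - q = (2p-1)q\<close> and \<open>2pq - p = (2q-1)p\<close> are the degrees of the leading terms.\<close>

definition X_part ::
    "nat \<Rightarrow> nat \<Rightarrow> (nat \<Rightarrow> nat \<Rightarrow> real) \<Rightarrow> nat \<Rightarrow> real \<Rightarrow> real \<Rightarrow> real"
  where "X_part p q a m x y =
    (if m = 2 * p * q - q then - real p * y ^ (2 * p - 1) else 0) +
    (\<Sum>(k, j)\<in>{(k, j) \<in> higher_indices p q ((2 * p - 1) * q). k * p + j * q = m}.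
       a k j * x ^ k * y ^ j)"

definition Y_part ::
    "nat \<Rightarrow> nat \<Rightarrow> (nat \<Rightarrow> nat \<Rightarrow> real) \<Rightarrow> nat \<Rightarrow> real \<Rightarrow> real \<Rightarrow> real"
  where "Y_part p q b m x y =
    (if m = 2 * p * q - p then real q * x ^ (2 * q - 1) else 0) +
    (\<Sum>(k, j)\<in>{(k, j) \<in> higher_indices p q ((2 * q - 1) * p). k * p + j * q = m}.
       b k j * x ^ k * y ^ j)"

text \<open>The substitution \<open>x = r^p cos \<theta>\<close>, \<open>y = r^q sin \<theta>\<close> turns the system into
  \<open>dr/d\<theta> = r (\<Sum>k. R_k(\<theta>) r^k) / (\<Sum>k. Q_k(\<theta>) r^k)\<close>.\<close>

definition R_coeff ::
    "nat \<Rightarrow> nat \<Rightarrow> (nat \<Rightarrow> nat \<Rightarrow> real) \<Rightarrow> (nat \<Rightarrow> nat \<Rightarrow> real) \<Rightarrow> nat \<Rightarrow> real \<Rightarrow> real"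
  where "R_coeff p q a b k \<theta> =
    cos \<theta> * X_part p q a (2 * p * q - q + k) (cos \<theta>) (sin \<theta>) +
    sin \<theta> * Y_part p q b (2 * p * q - p + k) (cos \<theta>) (sin \<theta>)"

definition Q_coeff ::
    "nat \<Rightarrow> nat \<Rightarrow> (nat \<Rightarrow> nat \<Rightarrow> real) \<Rightarrow> (nat \<Rightarrow> nat \<Rightarrow> real) \<Rightarrow> nat \<Rightarrow> real \<Rightarrow> real"
  where "Q_coeff p q a b k \<theta> =
    - real q * sin \<theta> * X_part p q a (2 * p * q - q + k) (cos \<theta>) (sin \<theta>) +
    real p * cos \<theta> * Y_part p q b (2 * p * q - p + k) (cos \<theta>) (sin \<theta>)"

text \<open>The first three conjuncts under the quantifier say that \<open>(\<theta>, s \<theta>)\<close> lies where the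
  right-hand side is defined; they hold whenever \<open>s \<theta>\<close> is small, of either sign.\<close>

definition polar_solution ::
    "nat \<Rightarrow> nat \<Rightarrow> (nat \<Rightarrow> nat \<Rightarrow> real) \<Rightarrow> (nat \<Rightarrow> nat \<Rightarrow> real) \<Rightarrow> real \<Rightarrow> (real \<Rightarrow> real) \<Rightarrow> bool"
  where "polar_solution p q a b h s \<longleftrightarrow> s 0 = h \<and>
    (\<forall>\<theta>. \<bar>\<theta>\<bar> < 4 * pi \<longrightarrow>
       summable (\<lambda>k. R_coeff p q a b k \<theta> * s \<theta> ^ k) \<and>
       summable (\<lambda>k. Q_coeff p q a b k \<theta> * s \<theta> ^ k) \<and>
       (\<Sum>k. Q_coeff p q a b k \<theta> * s \<theta> ^ k) \<noteq> 0 \<and>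
       (s has_real_derivative
          s \<theta> * (\<Sum>k. R_coeff p q a b k \<theta> * s \<theta> ^ k)
              / (\<Sum>k. Q_coeff p q a b k \<theta> * s \<theta> ^ k)) (at \<theta>))"

text \<open>\<open>r \<theta> h = (\<Sum>k\<ge>1. \<nu> k \<theta> h^k)\<close> for small \<open>h\<close>; the function \<open>\<nu> 0\<close> is irrelevant.
  The radius of convergence may depend on \<open>\<theta>\<close>.\<close>

definition solution_expansion ::
    "nat \<Rightarrow> nat \<Rightarrow> (nat \<Rightarrow> nat \<Rightarrow> real) \<Rightarrow> (nat \<Rightarrow> nat \<Rightarrow> real) \<Rightarrow>
     (real \<Rightarrow> real \<Rightarrow> real) \<Rightarrow> (nat \<Rightarrow> real \<Rightarrow> real) \<Rightarrow> bool"
  where "solution_expansion p q a b r \<nu> \<longleftrightarrow>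
    (\<exists>\<delta>>0. \<forall>h. \<bar>h\<bar> < \<delta> \<longrightarrow> polar_solution p q a b h (\<lambda>\<theta>. r \<theta> h)) \<and>
    (\<forall>\<theta>. \<bar>\<theta>\<bar> < 4 * pi \<longrightarrow>
       (\<exists>\<epsilon>>0. \<forall>h. \<bar>h\<bar> < \<epsilon> \<longrightarrow> (\<lambda>k. \<nu> (Suc k) \<theta> * h ^ Suc k) sums r \<theta> h))"

end

theory Submission
  imports Defs
begin

text \<open>Since \<open>p\<close> is even and \<open>q\<close> is odd, \<open>(r, \<theta>)\<close> and \<open>(-r, -\<theta>)\<close> describe the same point, so
  \<open>r(-\<theta>, h) = - r(\<theta>, -h)\<close> by uniqueness of small solutions. Together with the \<open>2\<pi>\<close>-periodicity of
  the equation, the return map \<open>P = r(2\<pi>, \<cdot>)\<close> satisfies \<open>P(-P(h)) = -h\<close>. Writing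
  \<open>P(h) = \<nu> h + c h^k + \<dots>\<close> and comparing coefficients gives \<open>\<nu>\<^sup>2 = 1\<close> and \<open>c ((-\<nu>)^k - \<nu>) = 0\<close>,
  which forces \<open>c = 0\<close> for odd \<open>k\<close>.\<close>

section \<open>Bounds and symmetries of the coefficients\<close>

text \<open>A Cauchy estimate. Convergence at the single point \<open>(t, t)\<close> makes
  \<open>\<bar>c k j\<bar> * t ^ (k + j)\<close> summable, and positive weights force
  \<open>k + j \<le> m\<close> in degree \<open>m\<close>. A monomial with
  \<open>\<bar>x\<bar>, \<bar>y\<bar> \<le> 1\<close> therefore exceeds its counterpart at
  \<open>(t, t)\<close> by a factor of at most \<open>(1 / t) ^ m\<close>.\<close>

lemma convergent_near_0_part_bound:
  assumes "convergent_near_0 c I" "p > 0" "q > 0"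
  obtains A M :: real where "A \<ge> 0" "M \<ge> 1"
    "\<And>m x y. \<bar>x\<bar> \<le> 1 \<Longrightarrow> \<bar>y\<bar> \<le> 1 \<Longrightarrow>
       \<bar>\<Sum>(k, j)\<in>{(k, j) \<in> I. k * p + j * q = m}. c k j * x ^ k * y ^ j\<bar> \<le> A * M ^ m"
proof -
  obtain \<rho> where \<rho>: "\<rho> > 0" and summ: "\<And>x y. \<bar>x\<bar> < \<rho> \<Longrightarrow> \<bar>y\<bar> < \<rho> \<Longrightarrow>
      (\<lambda>(k, j). c k j * x ^ k * y ^ j) summable_on I"
    using assms(1) unfolding convergent_near_0_def by blast
  \<comment> \<open>Halving keeps \<open>t\<close> strictly inside the region of convergence; the
    cap at 1 gives \<open>1 / t \<ge> 1\<close>, so raising the exponent from \<open>k + j\<close>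
    to \<open>m\<close> only enlarges the bound.\<close>
  define t where "t = min (\<rho> / 2) 1"
  have t: "t > 0" "t < \<rho>" "t \<le> 1" using \<rho> by (auto simp: t_def min_def)
  define f where "f = (\<lambda>(k, j). \<bar>c k j\<bar> * t ^ (k + j))"
  have f0: "f z \<ge> 0" for z using t by (auto simp: f_def split: prod.splits)
  have "(\<lambda>z. norm ((\<lambda>(k, j). c k j * t ^ k * t ^ j) z)) summable_on I"
    using summ[of t t] t by (subst summable_on_iff_abs_summable_on_real [symmetric]) auto
  also have "(\<lambda>z. norm ((\<lambda>(k, j). c k j * t ^ k * t ^ j) z)) = f"
    using t by (auto simp: f_def abs_mult power_add fun_eq_iff)
  finally have fs: "f summable_on I" .
  show thesis
  proof (rule that[of "infsum f I" "1 / t"])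
    show "infsum f I \<ge> 0" using f0 by (simp add: infsum_nonneg)
    show "1 / t \<ge> 1" using t by simp
    fix m and x y :: real
    assume xy: "\<bar>x\<bar> \<le> 1" "\<bar>y\<bar> \<le> 1"
    let ?S = "{(k, j) \<in> I. k * p + j * q = m}"
    have le: "k + j \<le> m" if "(k, j) \<in> ?S" for k j
    proof -
      have "k * 1 + j * 1 \<le> k * p + j * q"
        using assms(2,3) by (intro add_mono mult_le_mono) auto
      with that show ?thesis by auto
    qed
    have fin: "finite ?S"
      by (rule finite_subset[of _ "{..m} \<times> {..m}"]) (use le in fastforce)+
    have term_le: "\<bar>c k j * x ^ k * y ^ j\<bar> \<le> f (k, j) * (1 / t) ^ m" if "(k, j) \<in> ?S" for k j
    proof -
      have "\<bar>c k j * x ^ k * y ^ j\<bar> = \<bar>c k j\<bar> * (\<bar>x\<bar> ^ k * \<bar>y\<bar> ^ j)"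
        by (simp add: abs_mult power_abs)
      also have "\<dots> \<le> \<bar>c k j\<bar> * (1 * 1)"
        using xy by (intro mult_left_mono mult_mono power_le_one) auto
      also have "\<dots> = f (k, j) * (1 / t) ^ (k + j)"
        using t by (simp add: f_def power_divide)
      also have "\<dots> \<le> f (k, j) * (1 / t) ^ m"
        using t le[OF that] f0 by (intro mult_left_mono power_increasing) auto
      finally show ?thesis .
    qed
    have "\<bar>\<Sum>(k, j)\<in>?S. c k j * x ^ k * y ^ j\<bar> \<le> (\<Sum>z\<in>?S. f z * (1 / t) ^ m)"
      by (rule order.trans[OF sum_abs sum_mono]) (use term_le in auto)
    also have "\<dots> = sum f ?S * (1 / t) ^ m" by (simp add: sum_distrib_right)
    also have "\<dots> \<le> infsum f I * (1 / t) ^ m"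
      using t f0 fs fin by (intro mult_right_mono finite_sum_le_infsum) auto
    finally show "\<bar>\<Sum>(k, j)\<in>?S. c k j * x ^ k * y ^ j\<bar> \<le> infsum f I * (1 / t) ^ m" .
  qed
qed

text \<open>Absorbs the leading monomial, bounded by \<open>B\<close>, and the degree offset
  \<open>d\<close> into the constant of a geometric bound.\<close>

lemma geometric_bound_shift:
  fixes A B M :: real
  assumes "A \<ge> 0" "B \<ge> 0" "M \<ge> 1"
  shows "B + A * M ^ (d + n) \<le> (B + A * M ^ d) * M ^ n"
proof -
  have "B * 1 \<le> B * M ^ n" using assms by (intro mult_left_mono one_le_power) auto
  then show ?thesis by (simp add: power_add algebra_simps)
qed

lemma abs_mult_power_le:
  fixes c z :: real
  assumes "\<bar>z\<bar> \<le> 1"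
  shows "\<bar>c * z ^ n\<bar> \<le> \<bar>c\<bar>"
  unfolding abs_mult power_abs by (intro mult_left_le power_le_one assms abs_ge_zero)

text \<open>The offset \<open>d\<close> will be the degree of the leading term, so that
  \<open>n\<close> becomes the index of \<open>R_coeff\<close> and \<open>Q_coeff\<close>.\<close>

lemma X_part_bound:
  assumes "weight_system p q a b"
  obtains C M :: real where "C \<ge> 0" "M \<ge> 1"
    "\<And>n x y. \<bar>x\<bar> \<le> 1 \<Longrightarrow> \<bar>y\<bar> \<le> 1 \<Longrightarrow> \<bar>X_part p q a (d + n) x y\<bar> \<le> C * M ^ n"
proof -
  have conv: "convergent_near_0 a (higher_indices p q ((2 * p - 1) * q))" "p > 0" "q > 0"
    using assms by (auto simp: weight_system_def)
  obtain A M :: real where AM: "A \<ge> 0" "M \<ge> 1"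
    and bound: "\<And>m x y. \<bar>x\<bar> \<le> 1 \<Longrightarrow> \<bar>y\<bar> \<le> 1 \<Longrightarrow>
      \<bar>\<Sum>(k, j)\<in>{(k, j) \<in> higher_indices p q ((2 * p - 1) * q). k * p + j * q = m}.
         a k j * x ^ k * y ^ j\<bar> \<le> A * M ^ m"
    by (rule convergent_near_0_part_bound[OF conv]) blast
  show thesis
  proof (rule that[of "real p + A * M ^ d" M])
    fix n and x y :: real
    assume xy: "\<bar>x\<bar> \<le> 1" "\<bar>y\<bar> \<le> 1"
    have "\<bar>- real p * y ^ (2 * p - 1)\<bar> \<le> real p"
      using abs_mult_power_le[of y "- real p" "2 * p - 1"] xy by simp
    then have "\<bar>X_part p q a (d + n) x y\<bar> \<le> real p + A * M ^ (d + n)"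
      unfolding X_part_def
      by (intro order.trans[OF abs_triangle_ineq] add_mono bound[OF xy]) simp
    also have "\<dots> \<le> (real p + A * M ^ d) * M ^ n"
      using AM by (intro geometric_bound_shift) auto
    finally show "\<bar>X_part p q a (d + n) x y\<bar> \<le> (real p + A * M ^ d) * M ^ n" .
  qed (use AM in auto)
qed

lemma Y_part_bound:
  assumes "weight_system p q a b"
  obtains C M :: real where "C \<ge> 0" "M \<ge> 1"
    "\<And>n x y. \<bar>x\<bar> \<le> 1 \<Longrightarrow> \<bar>y\<bar> \<le> 1 \<Longrightarrow> \<bar>Y_part p q b (d + n) x y\<bar> \<le> C * M ^ n"
proof -
  have conv: "convergent_near_0 b (higher_indices p q ((2 * q - 1) * p))" "p > 0" "q > 0"
    using assms by (auto simp: weight_system_def)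
  obtain A M :: real where AM: "A \<ge> 0" "M \<ge> 1"
    and bound: "\<And>m x y. \<bar>x\<bar> \<le> 1 \<Longrightarrow> \<bar>y\<bar> \<le> 1 \<Longrightarrow>
      \<bar>\<Sum>(k, j)\<in>{(k, j) \<in> higher_indices p q ((2 * q - 1) * p). k * p + j * q = m}.
         b k j * x ^ k * y ^ j\<bar> \<le> A * M ^ m"
    by (rule convergent_near_0_part_bound[OF conv]) blast
  show thesis
  proof (rule that[of "real q + A * M ^ d" M])
    fix n and x y :: real
    assume xy: "\<bar>x\<bar> \<le> 1" "\<bar>y\<bar> \<le> 1"
    have "\<bar>real q * x ^ (2 * q - 1)\<bar> \<le> real q"
      using abs_mult_power_le[of x "real q" "2 * q - 1"] xy by simp
    then have "\<bar>Y_part p q b (d + n) x y\<bar> \<le> real q + A * M ^ (d + n)"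
      unfolding Y_part_def
      by (intro order.trans[OF abs_triangle_ineq] add_mono bound[OF xy]) simp
    also have "\<dots> \<le> (real q + A * M ^ d) * M ^ n"
      using AM by (intro geometric_bound_shift) auto
    finally show "\<bar>Y_part p q b (d + n) x y\<bar> \<le> (real q + A * M ^ d) * M ^ n" .
  qed (use AM in auto)
qed

text \<open>The bounds are uniform in the angle because \<open>cos \<theta>\<close> and
  \<open>sin \<theta>\<close> stay in the unit interval where the bounds on the parts apply.\<close>

lemma polar_coeff_bound:
  assumes "weight_system p q a b"
  obtains C M :: real where "C > 0" "M \<ge> 1"
    "\<And>n \<theta>. \<bar>R_coeff p q a b n \<theta>\<bar> \<le> C * M ^ n"
    "\<And>n \<theta>. \<bar>Q_coeff p q a b n \<theta>\<bar> \<le> C * M ^ n"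
proof -
  obtain C1 M1 :: real where 1: "C1 \<ge> 0" "M1 \<ge> 1"
    "\<And>n x y. \<bar>x\<bar> \<le> 1 \<Longrightarrow> \<bar>y\<bar> \<le> 1 \<Longrightarrow> \<bar>X_part p q a (2 * p * q - q + n) x y\<bar> \<le> C1 * M1 ^ n"
    using X_part_bound[OF assms] by metis
  obtain C2 M2 :: real where 2: "C2 \<ge> 0" "M2 \<ge> 1"
    "\<And>n x y. \<bar>x\<bar> \<le> 1 \<Longrightarrow> \<bar>y\<bar> \<le> 1 \<Longrightarrow> \<bar>Y_part p q b (2 * p * q - p + n) x y\<bar> \<le> C2 * M2 ^ n"
    using Y_part_bound[OF assms] by metis
  have pq: "real p \<ge> 1" "real q \<ge> 1" using assms by (auto simp: weight_system_def)
  define M where "M = max M1 M2"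
  \<comment> \<open>The summand 1 makes \<open>C\<close> strictly positive, since a radius will
    later be defined by dividing by it.\<close>
  define C where "C = q * C1 + p * C2 + 1"
  have comb: "\<bar>u * X_part p q a (2 * p * q - q + n) (cos \<theta>) (sin \<theta>) +
      v * Y_part p q b (2 * p * q - p + n) (cos \<theta>) (sin \<theta>)\<bar> \<le> C * M ^ n"
    if uv: "\<bar>u\<bar> \<le> real q" "\<bar>v\<bar> \<le> real p" for u v n \<theta>
  proof -
    have "C1 * M1 ^ n \<le> C1 * M ^ n" "C2 * M2 ^ n \<le> C2 * M ^ n"
      using 1 2 by (auto simp: M_def intro!: mult_left_mono power_mono)
    then have X: "\<bar>X_part p q a (2 * p * q - q + n) (cos \<theta>) (sin \<theta>)\<bar> \<le> C1 * M ^ n"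
      and Y: "\<bar>Y_part p q b (2 * p * q - p + n) (cos \<theta>) (sin \<theta>)\<bar> \<le> C2 * M ^ n"
      using 1(3)[of "cos \<theta>" "sin \<theta>" n] 2(3)[of "cos \<theta>" "sin \<theta>" n] by auto
    have "\<bar>u * X_part p q a (2 * p * q - q + n) (cos \<theta>) (sin \<theta>)\<bar> \<le> q * (C1 * M ^ n)"
      unfolding abs_mult using uv X by (intro mult_mono) auto
    moreover have "\<bar>v * Y_part p q b (2 * p * q - p + n) (cos \<theta>) (sin \<theta>)\<bar> \<le> p * (C2 * M ^ n)"
      unfolding abs_mult using uv Y by (intro mult_mono) auto
    moreover have "M ^ n \<ge> 0" using 1 by (auto simp: M_def)
    ultimately show ?thesis
      by (simp add: C_def distrib_right)
  qed
  show thesis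
  proof (rule that[of C M])
    show "C > 0" "M \<ge> 1" using 1 2 by (auto simp: C_def M_def intro!: add_nonneg_pos)
    fix n \<theta>
    show "\<bar>R_coeff p q a b n \<theta>\<bar> \<le> C * M ^ n"
      unfolding R_coeff_def using pq
      by (intro comb order.trans[OF abs_cos_le_one] order.trans[OF abs_sin_le_one])
    show "\<bar>Q_coeff p q a b n \<theta>\<bar> \<le> C * M ^ n"
      unfolding Q_coeff_def by (intro comb) (auto simp: abs_mult mult_left_le)
  qed
qed

section \<open>Positivity of the leading angular coefficient\<close>

lemma Q_coeff_0:
  assumes "p > 0" "q > 0"
  shows "Q_coeff p q a b 0 \<theta> = p * q * (cos \<theta> ^ (2 * q) + sin \<theta> ^ (2 * p))"
proof -
  \<comment> \<open>The strict inequality in \<open>higher_indices\<close> excludes the leading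
    degree, so only the leading monomials contribute at index 0.\<close>
  have empty: "{(k, j) \<in> higher_indices p q ((2 * p - 1) * q). k * p + j * q = 2 * p * q - q} = {}"
    "{(k, j) \<in> higher_indices p q ((2 * q - 1) * p). k * p + j * q = 2 * p * q - p} = {}"
    by (auto simp: higher_indices_def diff_mult_distrib algebra_simps)
  have "z * z ^ (2 * n - Suc 0) = z ^ (2 * n)" if "n > 0" for z :: real and n
    using that by (cases n) auto
  then show ?thesis
    using assms unfolding Q_coeff_def X_part_def Y_part_def add_0_right empty
    by (simp add: algebra_simps)
qed

text \<open>One of \<open>(cos \<theta>)\<^sup>2\<close> and \<open>(sin \<theta>)\<^sup>2\<close>
  is at least 1/2, and the exponent \<open>p + q\<close> covers both cases. A bound independent of
  the angle keeps the denominator of the polar equation away from 0 on a uniform range of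
  radii.\<close>

lemma Q_coeff_0_lower:
  assumes "p > 0" "q > 0"
  shows "Q_coeff p q a b 0 \<theta> \<ge> (1 / 2) ^ (p + q)"
proof -
  define S where "S = cos \<theta> ^ (2 * q) + sin \<theta> ^ (2 * p)"
  have nonneg: "cos \<theta> ^ (2 * q) \<ge> 0" "sin \<theta> ^ (2 * p) \<ge> 0"
    by (auto simp: power_mult)
  have "(cos \<theta>)\<^sup>2 \<ge> 1 / 2 \<or> (sin \<theta>)\<^sup>2 \<ge> 1 / 2"
    using sin_cos_squared_add[of \<theta>] by linarith
  then have "(1 / 2) ^ (p + q) \<le> S"
  proof
    assume "(cos \<theta>)\<^sup>2 \<ge> 1 / 2"
    then have "(1 / 2) ^ q \<le> cos \<theta> ^ (2 * q)"
      unfolding power_mult by (intro power_mono) auto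
    moreover have "(1 / 2 :: real) ^ (p + q) \<le> (1 / 2) ^ q" by (intro power_decreasing) auto
    ultimately show ?thesis using nonneg unfolding S_def by linarith
  next
    assume "(sin \<theta>)\<^sup>2 \<ge> 1 / 2"
    then have "(1 / 2) ^ p \<le> sin \<theta> ^ (2 * p)"
      unfolding power_mult by (intro power_mono) auto
    moreover have "(1 / 2 :: real) ^ (p + q) \<le> (1 / 2) ^ p" by (intro power_decreasing) auto
    ultimately show ?thesis using nonneg unfolding S_def by linarith
  qed
  also have "S \<le> real (p * q) * S"
    using nonneg assms mult_right_mono[of 1 "real (p * q)" S]
    by (simp add: S_def Suc_le_eq del: of_nat_mult)
  finally show ?thesis using assms by (simp add: Q_coeff_0 S_def)
qed

section \<open>Parity of the coefficients under reflection of the angle\<close>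

lemma weight_parity:
  assumes "even p" "odd q" "k * p + j * q = m"
  shows "(- 1 :: real) ^ j = (- 1) ^ m"
proof -
  have "even j \<longleftrightarrow> even m" using assms by auto
  then show ?thesis by (simp add: minus_one_power_iff)
qed

text \<open>For even \<open>p\<close> and odd \<open>q\<close> the weighted degree of a monomial has
  the parity of its exponent of \<open>y\<close>, so all monomials of one degree change by the same
  sign. The leading terms fit: degree \<open>2pq - q\<close> is odd, as is the exponent
  \<open>2p - 1\<close> of \<open>y\<close>, and degree \<open>2pq - p\<close> is even, with
  \<open>y\<close> absent.\<close>

lemma parts_minus_y:
  assumes "p > 0" "even p" "odd q"
  shows "X_part p q a m x (- y) = (- 1) ^ m * X_part p q a m x y" (is ?X)
    and "Y_part p q b m x (- y) = (- 1) ^ m * Y_part p q b m x y" (is ?Y)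
proof -
  have sum_eq: "(\<Sum>(k, j)\<in>{(k, j) \<in> I. k * p + j * q = m}. c k j * x ^ k * (- y) ^ j) =
      (- 1) ^ m * (\<Sum>(k, j)\<in>{(k, j) \<in> I. k * p + j * q = m}. c k j * x ^ k * y ^ j)"
    for I and c :: "nat \<Rightarrow> nat \<Rightarrow> real"
    unfolding sum_distrib_left
  proof (rule sum.cong[OF refl], safe)
    fix k j
    have "(- 1 :: real) ^ j = (- 1) ^ (k * p + j * q)" by (rule weight_parity[OF assms(2,3) refl])
    then show "c k j * x ^ k * (- y) ^ j = (- 1) ^ (k * p + j * q) * (c k j * x ^ k * y ^ j)"
      by (simp add: power_minus[of y])
  qed
  \<comment> \<open>These exclude truncation in the natural-number subtractions whose parity is
    needed next.\<close>
  have "q \<le> 2 * p * q" "p \<le> 2 * p * q" using assms by (auto simp: odd_pos Suc_leI)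
  then have par: "odd (2 * p * q - q)" "even (2 * p * q - p)" "odd (2 * p - Suc 0)"
    using assms by auto
  show ?X unfolding X_part_def sum_eq using par by (auto simp: algebra_simps)
  show ?Y unfolding Y_part_def sum_eq using par by (auto simp: algebra_simps)
qed

text \<open>Negating the angle fixes the cosine and negates the sine. The odd offset
  \<open>2pq - q\<close>, the even offset \<open>2pq - p\<close> and the explicit sine factors
  combine into one common sign for \<open>R_coeff\<close> and the opposite one for
  \<open>Q_coeff\<close>.\<close>

lemma polar_coeff_minus:
  assumes "p > 0" "even p" "odd q"
  shows "R_coeff p q a b n (- \<theta>) = - ((- 1) ^ n * R_coeff p q a b n \<theta>)"
    and "Q_coeff p q a b n (- \<theta>) = (- 1) ^ n * Q_coeff p q a b n \<theta>"
proof -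
  have "q \<le> 2 * p * q" "p \<le> 2 * p * q" using assms by (auto simp: odd_pos Suc_leI)
  then have "odd (2 * p * q - q)" "even (2 * p * q - p)" using assms by auto
  then have "(- 1 :: real) ^ (2 * p * q - q + n) = - ((- 1) ^ n)"
    "(- 1 :: real) ^ (2 * p * q - p + n) = (- 1) ^ n"
    by (auto simp: power_add)
  then show "R_coeff p q a b n (- \<theta>) = - ((- 1) ^ n * R_coeff p q a b n \<theta>)"
    "Q_coeff p q a b n (- \<theta>) = (- 1) ^ n * Q_coeff p q a b n \<theta>"
    using parts_minus_y[OF assms] by (simp_all add: R_coeff_def Q_coeff_def algebra_simps)
qed

section \<open>The polar vector field\<close>

text \<open>Made total by convention: where a series diverges or the denominator vanishes, the value
  carries no meaning. Estimates are therefore restricted to small \<open>u\<close>.\<close>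

definition polar_field ::
    "nat \<Rightarrow> nat \<Rightarrow> (nat \<Rightarrow> nat \<Rightarrow> real) \<Rightarrow> (nat \<Rightarrow> nat \<Rightarrow> real) \<Rightarrow> real \<Rightarrow> real \<Rightarrow> real"
  where "polar_field p q a b \<theta> u =
    u * (\<Sum>k. R_coeff p q a b k \<theta> * u ^ k) / (\<Sum>k. Q_coeff p q a b k \<theta> * u ^ k)"

lemma polar_field_periodic: "polar_field p q a b (\<theta> + 2 * pi) u = polar_field p q a b \<theta> u"
  by (simp add: polar_field_def R_coeff_def Q_coeff_def)

text \<open>The sign \<open>(-1)^k\<close> of the coefficients cancels that of
  \<open>(-u)^k\<close>. The remaining minus of the numerator series, pulled out by summability,
  cancels against the prefactor \<open>u\<close>.\<close>

lemma polar_field_minus: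
  assumes "p > 0" "even p" "odd q" "summable (\<lambda>k. R_coeff p q a b k \<theta> * u ^ k)"
  shows "polar_field p q a b (- \<theta>) (- u) = polar_field p q a b \<theta> u"
proof -
  have sq: "(- 1 :: real) ^ k * (- 1) ^ k = 1" for k
    by (simp flip: power_mult_distrib)
  have "(\<lambda>k. R_coeff p q a b k (- \<theta>) * (- u) ^ k) = (\<lambda>k. - (R_coeff p q a b k \<theta> * u ^ k))"
    "(\<lambda>k. Q_coeff p q a b k (- \<theta>) * (- u) ^ k) = (\<lambda>k. Q_coeff p q a b k \<theta> * u ^ k)"
    using sq by (auto simp: polar_coeff_minus[OF assms(1-3)] power_minus[of u] fun_eq_iff)
  then show ?thesis
    using assms(4) by (simp add: polar_field_def suminf_minus)
qed

text \<open>Writing \<open>M ^ n * w ^ n\<close> as \<open>(1 / 2) ^ n * (2 * M * w) ^ n\<close>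
  with \<open>\<bar>2 * M * w\<bar> \<le> 1\<close> bounds the differences of powers linearly in
  \<open>n\<close>, and the factor \<open>(1 / 2) ^ n\<close> makes the sum converge.\<close>

lemma powser_lipschitz:
  fixes c :: "nat \<Rightarrow> real"
  assumes M: "M > 0" and c: "\<And>n. \<bar>c n\<bar> \<le> C * M ^ n"
    and u: "\<bar>u\<bar> \<le> 1 / (2 * M)" and v: "\<bar>v\<bar> \<le> 1 / (2 * M)"
  shows "\<bar>(\<Sum>n. c n * u ^ n) - (\<Sum>n. c n * v ^ n)\<bar> \<le> 8 * C * M * \<bar>u - v\<bar>"
proof -
  have C: "C \<ge> 0" using c[of 0] by simp
  have scale: "M ^ n * w ^ n = (1 / 2) ^ n * (2 * M * w) ^ n" for w n
    by (simp flip: power_mult_distrib)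
  have small: "\<bar>2 * M * w\<bar> \<le> 1" if "\<bar>w\<bar> \<le> 1 / (2 * M)" for w
    using that M by (simp add: abs_mult field_simps)
  have summ: "summable (\<lambda>n. c n * w ^ n)" if "\<bar>w\<bar> \<le> 1 / (2 * M)" for w
  proof (rule summable_comparison_test'[of "\<lambda>n. C * (1 / 2) ^ n" 0])
    fix n
    have "\<bar>c n * w ^ n\<bar> \<le> C * (M ^ n * \<bar>w\<bar> ^ n)"
      using mult_right_mono[OF c[of n], of "\<bar>w\<bar> ^ n"] by (simp add: abs_mult power_abs mult.assoc)
    also have "\<dots> = C * ((1 / 2) ^ n * \<bar>2 * M * w\<bar> ^ n)"
      using M unfolding scale by (simp add: abs_mult)
    also have "\<dots> \<le> C * ((1 / 2) ^ n * 1)"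
      using C small[OF that] by (intro mult_left_mono power_le_one) auto
    finally show "norm (c n * w ^ n) \<le> C * (1 / 2) ^ n" by simp
  qed (simp add: summable_geometric)
  \<comment> \<open>The factor \<open>Suc n\<close> instead of \<open>n\<close> matches the
    derivative of the geometric series, whose value 4 at 1/2 yields the constant 8.\<close>
  let ?g = "\<lambda>n. 2 * C * M * \<bar>u - v\<bar> * (real (Suc n) * (1 / 2) ^ n)"
  have diff: "\<bar>c n * u ^ n - c n * v ^ n\<bar> \<le> ?g n" for n
  proof -
    have "\<bar>c n * u ^ n - c n * v ^ n\<bar> = \<bar>c n\<bar> * \<bar>u ^ n - v ^ n\<bar>"
      by (simp flip: abs_mult right_diff_distrib)
    also have "\<dots> \<le> C * M ^ n * \<bar>u ^ n - v ^ n\<bar>" using c by (intro mult_right_mono) auto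
    also have "\<dots> = C * \<bar>M ^ n * u ^ n - M ^ n * v ^ n\<bar>"
      using M by (simp add: abs_mult flip: right_diff_distrib)
    also have "\<dots> = C * (1 / 2) ^ n * \<bar>(2 * M * u) ^ n - (2 * M * v) ^ n\<bar>"
      unfolding scale by (simp add: abs_mult flip: right_diff_distrib)
    also have "\<dots> \<le> C * (1 / 2) ^ n * (real n * \<bar>2 * M * u - 2 * M * v\<bar>)"
      using C norm_power_diff[of "2 * M * u" "2 * M * v" n] small[OF u] small[OF v]
      by (intro mult_left_mono) auto
    also have "\<bar>2 * M * u - 2 * M * v\<bar> = 2 * M * \<bar>u - v\<bar>"
      using M by (simp add: abs_mult flip: right_diff_distrib)
    also have "C * (1 / 2) ^ n * (real n * (2 * M * \<bar>u - v\<bar>)) \<le>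
        C * (1 / 2) ^ n * (real (Suc n) * (2 * M * \<bar>u - v\<bar>))"
      using C M by (intro mult_left_mono mult_right_mono) auto
    finally show ?thesis by (simp add: mult_ac)
  qed
  have "(\<lambda>n. real (Suc n) * (1 / 2) ^ n) sums 4"
    using geometric_deriv_sums[of "1 / 2 :: real"] by (simp add: power2_eq_square)
  then have "?g sums
      (2 * C * M * \<bar>u - v\<bar> * 4)"
    by (rule sums_mult)
  then have "summable ?g" "suminf ?g = 2 * C * M * \<bar>u - v\<bar> * 4"
    by (simp_all only: sums_iff)
  moreover have "(\<lambda>n. c n * u ^ n - c n * v ^ n) sums
      ((\<Sum>n. c n * u ^ n) - (\<Sum>n. c n * v ^ n))"
    using summ u v by (intro sums_diff summable_sums)
  ultimately have "\<bar>(\<Sum>n. c n * u ^ n) - (\<Sum>n. c n * v ^ n)\<bar> \<le> 2 * C * M * \<bar>u - v\<bar> * 4"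
    using diff norm_suminf_le[of "\<lambda>n. c n * u ^ n - c n * v ^ n" ?g] by (simp add: sums_iff)
  then show ?thesis by simp
qed

text \<open>Numerator and denominator are Lipschitz for small radius and the denominator stays above
  half of its lower bound at radius 0, so the quotient is Lipschitz with constants independent of
  the angle.\<close>

lemma polar_field_lipschitz:
  assumes ws: "weight_system p q a b"
  obtains \<rho> L where "\<rho> > 0" "L \<ge> 0"
    "\<And>\<theta> u v. \<bar>u\<bar> \<le> \<rho> \<Longrightarrow> \<bar>v\<bar> \<le> \<rho> \<Longrightarrow>
      \<bar>polar_field p q a b \<theta> u - polar_field p q a b \<theta> v\<bar> \<le> L * \<bar>u - v\<bar>"
proof -
  obtain C M :: real where C: "C > 0" and M: "M \<ge> 1"
    and R: "\<And>n \<theta>. \<bar>R_coeff p q a b n \<theta>\<bar> \<le> C * M ^ n"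
    and Q: "\<And>n \<theta>. \<bar>Q_coeff p q a b n \<theta>\<bar> \<le> C * M ^ n"
    using polar_coeff_bound[OF ws] by metis
  define \<mu> :: real where "\<mu> = (1 / 2) ^ (p + q)"
  have \<mu>: "\<mu> > 0" and Q0: "Q_coeff p q a b 0 \<theta> \<ge> \<mu>" for \<theta>
    using ws Q_coeff_0_lower[of p q a b \<theta>] by (auto simp: \<mu>_def weight_system_def)
  \<comment> \<open>The first bound is the range of \<open>powser_lipschitz\<close>; the second lets
    the denominator move by at most \<open>\<mu> / 2\<close> from its value at 0.\<close>
  define \<rho> where "\<rho> = min (1 / (2 * M)) (\<mu> / (16 * C * M))"
  \<comment> \<open>The two summands come from varying the numerator and the denominator of the
    quotient separately.\<close>
  define L where "L = 18 * C / \<mu> + 80 * C\<^sup>2 / \<mu>\<^sup>2"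
  have \<rho>: "\<rho> > 0" "\<rho> \<le> 1 / (2 * M)" "8 * C * M * \<rho> \<le> \<mu> / 2"
  proof -
    show "\<rho> > 0" "\<rho> \<le> 1 / (2 * M)" using C M \<mu> by (auto simp: \<rho>_def)
    have "8 * C * M * \<rho> \<le> 8 * C * M * (\<mu> / (16 * C * M))"
      using C M by (intro mult_left_mono) (auto simp: \<rho>_def)
    also have "\<dots> = \<mu> / 2" using C M by (simp add: field_simps)
    finally show "8 * C * M * \<rho> \<le> \<mu> / 2" .
  qed
  show thesis
  proof (rule that[of \<rho> L])
    show "L \<ge> 0" using C \<mu> by (auto simp: L_def)
    fix \<theta> u v
    assume u: "\<bar>u\<bar> \<le> \<rho>" and v: "\<bar>v\<bar> \<le> \<rho>"
    define N where "N w = (\<Sum>k. R_coeff p q a b k \<theta> * w ^ k)" for w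
    define D where "D w = (\<Sum>k. Q_coeff p q a b k \<theta> * w ^ k)" for w
    have field_eq: "polar_field p q a b \<theta> w = w * N w / D w" for w
      by (simp add: polar_field_def N_def D_def)
    have Nlip: "\<bar>N x - N y\<bar> \<le> 8 * C * M * \<bar>x - y\<bar>" 
      and Dlip: "\<bar>D x - D y\<bar> \<le> 8 * C * M * \<bar>x - y\<bar>" if "\<bar>x\<bar> \<le> \<rho>" "\<bar>y\<bar> \<le> \<rho>" for x y
      unfolding N_def D_def using that \<rho> M R Q by (auto intro!: powser_lipschitz)
    have D_lower: "D w \<ge> \<mu> / 2" if w: "\<bar>w\<bar> \<le> \<rho>" for w
    proof -
      have "\<bar>D w - D 0\<bar> \<le> 8 * C * M * \<bar>w\<bar>" using Dlip[of w 0] w \<rho> by simp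
      also have "\<dots> \<le> 8 * C * M * \<rho>" using w C M by (intro mult_left_mono) auto
      finally have "\<bar>D w - D 0\<bar> \<le> \<mu> / 2" using \<rho> by simp
      moreover have "D 0 = Q_coeff p q a b 0 \<theta>" by (simp add: D_def)
      ultimately show ?thesis using Q0[of \<theta>] by linarith
    qed
    have N_upper: "\<bar>N w\<bar> \<le> 5 * C" if w: "\<bar>w\<bar> \<le> \<rho>" for w
    proof -
      have "\<bar>N w - N 0\<bar> \<le> 8 * C * M * \<bar>w\<bar>" using Nlip[of w 0] w \<rho> by simp
      also have "\<dots> \<le> 8 * C * M * (1 / (2 * M))" using w \<rho> C M by (intro mult_left_mono) auto
      also have "\<dots> = 4 * C" using M by simp
      finally have "\<bar>N w - N 0\<bar> \<le> 4 * C" .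
      moreover have "\<bar>N 0\<bar> \<le> C" using R[of 0 \<theta>] by (simp add: N_def)
      ultimately show ?thesis by linarith
    qed
    have "\<bar>u * N u - v * N v\<bar> = \<bar>u * (N u - N v) + (u - v) * N v\<bar>"
      by (simp add: algebra_simps)
    also have "\<dots> \<le> \<bar>u\<bar> * \<bar>N u - N v\<bar> + \<bar>u - v\<bar> * \<bar>N v\<bar>"
      by (metis abs_mult abs_triangle_ineq)
    also have "\<dots> \<le> 1 / (2 * M) * (8 * C * M * \<bar>u - v\<bar>) + \<bar>u - v\<bar> * (5 * C)"
      using u v \<rho> M Nlip N_upper by (intro add_mono mult_mono) auto
    also have "\<dots> = 9 * C * \<bar>u - v\<bar>" using M by simp
    finally have num: "\<bar>u * N u - v * N v\<bar> \<le> 9 * C * \<bar>u - v\<bar>" .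
    have Du: "D u \<ge> \<mu> / 2" and Dv: "D v \<ge> \<mu> / 2" using D_lower u v by auto
    have pos: "D u > 0" "D v > 0" using Du Dv \<mu> by auto
    have inv: "1 / D u \<le> 2 / \<mu>" "1 / D v \<le> 2 / \<mu>"
      using Du Dv pos \<mu> by (auto simp: field_simps)
    have "polar_field p q a b \<theta> u - polar_field p q a b \<theta> v =
        (u * N u - v * N v) * (1 / D u) + v * N v * (D v - D u) * (1 / D u * (1 / D v))"
      using pos by (simp add: field_eq field_simps)
    also have "\<bar>\<dots>\<bar> \<le> \<bar>u * N u - v * N v\<bar> * (1 / D u) +
        \<bar>v\<bar> * \<bar>N v\<bar> * \<bar>D v - D u\<bar> * (1 / D u * (1 / D v))"
      using pos by (intro order.trans[OF abs_triangle_ineq]) (simp add: abs_mult)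
    also have "\<dots> \<le> 9 * C * \<bar>u - v\<bar> * (2 / \<mu>) +
        1 / (2 * M) * (5 * C) * (8 * C * M * \<bar>u - v\<bar>) * (2 / \<mu> * (2 / \<mu>))"
      using u v \<rho> C M \<mu> pos inv num N_upper[OF v] Dlip[OF v u]
      by (intro add_mono mult_mono) (auto simp: abs_minus_commute)
    also have "\<dots> = L * \<bar>u - v\<bar>"
      using M by (simp add: L_def power2_eq_square field_simps)
    finally show "\<bar>polar_field p q a b \<theta> u - polar_field p q a b \<theta> v\<bar> \<le> L * \<bar>u - v\<bar>" .
  qed (use \<rho> in auto)
qed

section \<open>Growth of solutions\<close>

text \<open>Gronwall's inequality, obtained by showing that
  \<open>exp (- 2 * L * t) * (f t)\<^sup>2\<close> is nonincreasing; the square avoids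
  differentiating an absolute value.\<close>

lemma exp_growth_bound_right:
  fixes f f' :: "real \<Rightarrow> real"
  assumes der: "\<And>t. 0 \<le> t \<Longrightarrow> t \<le> T \<Longrightarrow> (f has_real_derivative f' t) (at t)"
    and bound: "\<And>t. 0 \<le> t \<Longrightarrow> t \<le> T \<Longrightarrow> \<bar>f' t\<bar> \<le> L * \<bar>f t\<bar>"
    and T: "0 \<le> T"
  shows "\<bar>f T\<bar> \<le> \<bar>f 0\<bar> * exp (L * T)"
proof -
  define g where "g t = exp (- 2 * L * t) * (f t)\<^sup>2" for t
  have "g T \<le> g 0"
  proof (rule DERIV_nonpos_imp_nonincreasing[OF T])
    fix t assume t: "0 \<le> t" "t \<le> T"
    have "f t * f' t \<le> \<bar>f t\<bar> * \<bar>f' t\<bar>" by (metis abs_ge_self abs_mult)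
    also have "\<dots> \<le> \<bar>f t\<bar> * (L * \<bar>f t\<bar>)" using bound[OF t] by (intro mult_left_mono) auto
    also have "\<dots> = L * (f t)\<^sup>2" by (simp add: power2_eq_square)
    finally have "exp (- 2 * L * t) * (2 * (f t * f' t - L * (f t)\<^sup>2)) \<le> 0"
      by (intro mult_nonneg_nonpos) auto
    moreover have "(g has_real_derivative
        exp (- 2 * L * t) * (2 * (f t * f' t - L * (f t)\<^sup>2))) (at t)"
      unfolding g_def using der[OF t]
      by (auto intro!: derivative_eq_intros simp: algebra_simps power2_eq_square)
    ultimately show "\<exists>y. (g has_real_derivative y) (at t) \<and> y \<le> 0" by blast
  qed
  then have "exp (- 2 * L * T) * (f T)\<^sup>2 * exp (2 * L * T) \<le> (f 0)\<^sup>2 * exp (2 * L * T)"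
    by (simp add: g_def)
  also have "exp (- 2 * L * T) * (f T)\<^sup>2 * exp (2 * L * T) = (f T)\<^sup>2"
    by (simp add: exp_minus)
  also have "(f 0)\<^sup>2 * exp (2 * L * T) = (\<bar>f 0\<bar> * exp (L * T))\<^sup>2"
    by (simp add: power_mult_distrib mult.assoc flip: exp_double)
  finally show ?thesis using abs_le_square_iff[of "f T" "\<bar>f 0\<bar> * exp (L * T)"] by simp
qed

text \<open>The differential inequality is only assumed where \<open>f\<close> is small; a solution that starts
  small enough never leaves that region.\<close>

lemma small_growth_bound_right:
  fixes f f' :: "real \<Rightarrow> real"
  assumes der: "\<And>t. 0 \<le> t \<Longrightarrow> t \<le> T \<Longrightarrow> (f has_real_derivative f' t) (at t)"
    and bound: "\<And>t. 0 \<le> t \<Longrightarrow> t \<le> T \<Longrightarrow> \<bar>f t\<bar> \<le> \<rho> \<Longrightarrow> \<bar>f' t\<bar> \<le> L * \<bar>f t\<bar>"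
    and T: "0 \<le> T" and L: "0 \<le> L" and small: "\<bar>f 0\<bar> * exp (L * T) < \<rho>"
  shows "\<bar>f T\<bar> \<le> \<bar>f 0\<bar> * exp (L * T)"
proof -
  have "\<bar>f t\<bar> < \<rho>" if t: "0 \<le> t" "t \<le> T" for t
  proof (rule ccontr)
    assume "\<not> \<bar>f t\<bar> < \<rho>"
    \<comment> \<open>\<open>Inf S\<close> is the first exit time. The growth bound holds before it
      and passes to it by continuity from the left, contradicting \<open>small\<close>.\<close>
    define S where "S = {s \<in> {0..T}. \<rho> \<le> \<bar>f s\<bar>}"
    have "S \<noteq> {}" using t \<open>\<not> \<bar>f t\<bar> < \<rho>\<close> by (auto simp: S_def)
    have cont: "continuous_on {0..T} f"
      by (intro continuous_at_imp_continuous_on ballI DERIV_isCont[OF der]) auto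
    have "closed S" unfolding S_def
      by (intro continuous_on_closed_Collect_le continuous_intros cont)
    moreover have "bdd_below S" by (auto simp: S_def intro!: bdd_belowI[of _ 0])
    ultimately have "Inf S \<in> S" using \<open>S \<noteq> {}\<close> by (intro closed_contains_Inf)
    then have t0: "0 \<le> Inf S" "Inf S \<le> T" "\<rho> \<le> \<bar>f (Inf S)\<bar>" by (auto simp: S_def)
    have before: "\<bar>f s\<bar> < \<rho>" if "0 \<le> s" "s < Inf S" for s
    proof (rule ccontr)
      assume "\<not> \<bar>f s\<bar> < \<rho>"
      then have "s \<in> S" using that t0 by (auto simp: S_def)
      then show False using cInf_lower[OF _ \<open>bdd_below S\<close>] that by fastforce
    qed
    have est: "\<bar>f s\<bar> \<le> \<bar>f 0\<bar> * exp (L * T)" if s: "0 \<le> s" "s < Inf S" for s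
    proof -
      have "\<bar>f s\<bar> \<le> \<bar>f 0\<bar> * exp (L * s)"
      proof (rule exp_growth_bound_right)
        show "(f has_real_derivative f' x) (at x)" if "0 \<le> x" "x \<le> s" for x
          using that s t0 by (intro der) auto
        show "\<bar>f' x\<bar> \<le> L * \<bar>f x\<bar>" if "0 \<le> x" "x \<le> s" for x
          using that s t0 before[of x] by (intro bound) auto
      qed (use s in auto)
      also have "\<dots> \<le> \<bar>f 0\<bar> * exp (L * T)"
        using s t0 L by (intro mult_left_mono) (auto intro: mult_left_mono)
      finally show ?thesis .
    qed
    \<comment> \<open>This puts the initial value below \<open>\<rho>\<close>, so the exit time is
      positive and the left limit can be used.\<close>
    have "\<bar>f 0\<bar> * 1 \<le> \<bar>f 0\<bar> * exp (L * T)" using L T by (intro mult_left_mono) auto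
    then have "Inf S \<noteq> 0" using t0 small by auto
    then have "0 < Inf S" using t0 by simp
    have "((\<lambda>s. \<bar>f s\<bar>) \<longlongrightarrow> \<bar>f (Inf S)\<bar>) (at_left (Inf S))"
      using DERIV_isCont[OF der[OF t0(1,2)]]
      by (intro tendsto_rabs) (simp add: isCont_def filterlim_at_split)
    moreover have "\<forall>\<^sub>F s in at_left (Inf S). \<bar>f s\<bar> \<le> \<bar>f 0\<bar> * exp (L * T)"
      using eventually_at_left_real[OF \<open>0 < Inf S\<close>] by eventually_elim (use est in auto)
    ultimately have "\<bar>f (Inf S)\<bar> \<le> \<bar>f 0\<bar> * exp (L * T)"
      by (intro tendsto_upperbound) auto
    then show False using t0 small by simp
  qed
  then show ?thesis using bound by (intro exp_growth_bound_right[OF der _ T]) force+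
qed

text \<open>Negative times reduce to positive ones through the reversed function
  \<open>f (- s)\<close>.\<close>

lemma small_growth_bound:
  fixes f f' :: "real \<Rightarrow> real"
  assumes der: "\<And>t. \<bar>t\<bar> \<le> T \<Longrightarrow> (f has_real_derivative f' t) (at t)"
    and bound: "\<And>t. \<bar>t\<bar> \<le> T \<Longrightarrow> \<bar>f t\<bar> \<le> \<rho> \<Longrightarrow> \<bar>f' t\<bar> \<le> L * \<bar>f t\<bar>"
    and L: "0 \<le> L" and small: "\<bar>f 0\<bar> * exp (L * T) < \<rho>" and t: "\<bar>t\<bar> \<le> T"
  shows "\<bar>f t\<bar> \<le> \<bar>f 0\<bar> * exp (L * T)"
proof -
  have mono: "\<bar>f 0\<bar> * exp (L * \<bar>t\<bar>) \<le> \<bar>f 0\<bar> * exp (L * T)"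
    using L t by (intro mult_left_mono) (auto intro: mult_left_mono)
  have "\<bar>f t\<bar> \<le> \<bar>f 0\<bar> * exp (L * \<bar>t\<bar>)"
  proof (cases "t \<ge> 0")
    case True
    then show ?thesis
      using small_growth_bound_right[of t f f' \<rho> L] der bound L small t mono by force
  next
    case False
    have der': "((\<lambda>s. f (- s)) has_real_derivative - f' (- s)) (at s)" if "\<bar>s\<bar> \<le> T" for s
      using der[of "- s"] that by (simp add: DERIV_mirror)
    show ?thesis
      using small_growth_bound_right[of "- t" "\<lambda>s. f (- s)" "\<lambda>s. - f' (- s)" \<rho> L]
        der' bound L small t mono False by force
  qed
  with mono show ?thesis by simp
qed

section \<open>The return map\<close>

text \<open>Writing \<open>P h = c 1 * h + h ^ k * g h\<close> reduces the comparison of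
  coefficients in \<open>P (- P h) = - h\<close> to limits at 0, so power series need not be
  composed.\<close>

lemma involutive_powser_leading_coeff:
  fixes P :: "real \<Rightarrow> real" and c :: "nat \<Rightarrow> real"
  assumes \<epsilon>: "\<epsilon> > 0" and P: "\<And>h. \<bar>h\<bar> < \<epsilon> \<Longrightarrow> (\<lambda>n. c (Suc n) * h ^ Suc n) sums P h"
    and inv: "\<And>h. \<bar>h\<bar> < \<epsilon> \<Longrightarrow> \<bar>P h\<bar> < \<epsilon> \<Longrightarrow> P (- P h) = - h"
    and k: "k > 1" and zero: "\<And>j. 1 < j \<Longrightarrow> j < k \<Longrightarrow> c j = 0" and "c k \<noteq> 0"
  shows "even k"
proof (rule ccontr)
  assume "odd k"
  \<comment> \<open>The value \<open>c k\<close> at 0 is the continuous extension: \<open>g\<close>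
    is the power series with coefficients \<open>c (n + k)\<close>.\<close>
  define g where "g h = (if h = 0 then c k else (P h - c 1 * h) / h ^ k)" for h
  have P_eq: "P h = c 1 * h + h ^ k * g h" if "\<bar>h\<bar> < \<epsilon>" for h
  proof (cases "h = 0")
    case True
    with P[of 0] \<epsilon> k show ?thesis by (simp add: sums_iff)
  qed (simp add: g_def)
  have g_sums: "(\<lambda>n. c (n + k) * h ^ n) sums g h" if h: "norm h < \<epsilon>" for h
  proof (cases "h = 0")
    case True
    then show ?thesis using powser_sums_zero[of "\<lambda>n. c (n + k)"] by (simp add: g_def)
  next
    case False
    \<comment> \<open>The series starts at \<open>c 1\<close>, so \<open>k - 1\<close> initial terms
      are split off; all but the linear one vanish by \<open>zero\<close>.\<close>
    have "(\<lambda>n. c (Suc (n + (k - 1))) * h ^ Suc (n + (k - 1))) sums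
        (P h - (\<Sum>i<k - 1. c (Suc i) * h ^ Suc i))"
      using P[of h] h by (intro sums_split_initial_segment) auto
    moreover have "c (Suc i) = 0" if "i \<noteq> 0" "i < k - 1" for i
      using zero[of "Suc i"] that by simp
    then have "(\<Sum>i<k - 1. c (Suc i) * h ^ Suc i) = (\<Sum>i\<in>{0}. c (Suc i) * h ^ Suc i)"
      using k by (intro sum.mono_neutral_right) auto
    ultimately have "(\<lambda>n. c (n + k) * h ^ (n + k)) sums (P h - c 1 * h)" using k by simp
    from sums_divide[OF this, of "h ^ k"] show ?thesis
      using False by (simp add: g_def power_add)
  qed
  have g_lim: "(g \<longlongrightarrow> c k) (at 0)"
    using powser_limit_0[OF \<epsilon> g_sums] by simp
  then have g_cont: "isCont g 0" by (simp add: isCont_def g_def)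
  have ev: "\<forall>\<^sub>F h in at 0. \<bar>h\<bar> < \<epsilon> \<and> h \<noteq> 0"
    using \<epsilon> by (auto simp: eventually_at dist_real_def)
  have "((\<lambda>h. c 1 + h ^ (k - 1) * g h) \<longlongrightarrow> c 1 + 0 ^ (k - 1) * c k) (at 0)"
    by (intro tendsto_intros g_lim)
  moreover have "\<forall>\<^sub>F h in at 0. c 1 + h ^ (k - 1) * g h = P h / h"
    using ev
  proof eventually_elim
    case (elim h)
    have "h ^ k = h * h ^ (k - 1)" using k by (cases k) auto
    with elim show ?case by (simp add: P_eq field_simps)
  qed
  ultimately have slope: "((\<lambda>h. P h / h) \<longlongrightarrow> c 1) (at 0)"
    using k by (auto intro: Lim_transform_eventually simp: power_0_left)
  have "((\<lambda>h. P h / h * h) \<longlongrightarrow> c 1 * 0) (at 0)" by (intro tendsto_intros slope)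
  moreover have "\<forall>\<^sub>F h in at 0. P h / h * h = P h" using ev by eventually_elim simp
  ultimately have P_lim: "(P \<longlongrightarrow> 0) (at 0)" using Lim_transform_eventually by fastforce
  then have P_small: "\<forall>\<^sub>F h in at 0. \<bar>P h\<bar> < \<epsilon>"
    using \<epsilon> by (auto simp: tendsto_iff dist_real_def)
  \<comment> \<open>Continuity of \<open>g\<close> at 0 is used, and not just its limit, because
    this composition does not presuppose \<open>P h \<noteq> 0\<close> for
    \<open>h \<noteq> 0\<close>.\<close>
  have "((\<lambda>h. g (- P h)) \<longlongrightarrow> g 0) (at 0)"
    using isCont_tendsto_compose[OF g_cont, of "\<lambda>h. - P h" "at 0"] tendsto_minus[OF P_lim] by simp
  then have gP: "((\<lambda>h. g (- P h)) \<longlongrightarrow> c k) (at 0)" by (simp add: g_def)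
  \<comment> \<open>The expansion is inserted twice and a factor \<open>h\<close> cancelled. The
    limit first gives \<open>c 1 * c 1 = 1\<close>; then \<open>h ^ (k - 1)\<close> can be
    cancelled, and a second limit gives the relation of order \<open>k\<close>.\<close>
  have eq: "\<forall>\<^sub>F h in at 0. c 1 * c 1 - 1 =
      h ^ (k - 1) * (- c 1 * g h + (- (P h / h)) ^ k * g (- P h))"
    using ev P_small
  proof eventually_elim
    case (elim h)
    have "- h = c 1 * (- P h) + (- P h) ^ k * g (- P h)"
      using inv[of h] P_eq[of "- P h"] elim by simp
    also have "c 1 * (- P h) = - (c 1 * c 1 * h) - c 1 * h ^ k * g h"
      using P_eq[of h] elim by (simp add: algebra_simps)
    also have "(- P h) ^ k = h ^ k * (- (P h / h)) ^ k"
      using elim by (simp flip: power_mult_distrib)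
    also have "h ^ k = h * h ^ (k - 1)" using k by (cases k) auto
    finally have "h * (c 1 * c 1 - 1) =
        h * (h ^ (k - 1) * (- c 1 * g h + (- (P h / h)) ^ k * g (- P h)))"
      by (simp add: algebra_simps)
    with elim show ?case by (metis mult_left_cancel)
  qed
  have W: "((\<lambda>h. - c 1 * g h + (- (P h / h)) ^ k * g (- P h)) \<longlongrightarrow>
      - c 1 * c k + (- c 1) ^ k * c k) (at 0)"
    by (intro tendsto_intros g_lim slope gP)
  have "((\<lambda>h. h ^ (k - 1) * (- c 1 * g h + (- (P h / h)) ^ k * g (- P h))) \<longlongrightarrow>
      0 ^ (k - 1) * (- c 1 * c k + (- c 1) ^ k * c k)) (at (0::real))"
    by (intro tendsto_mult[OF _ W] tendsto_intros)
  moreover have "\<forall>\<^sub>F h in at 0. h ^ (k - 1) * (- c 1 * g h + (- (P h / h)) ^ k * g (- P h)) =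
      c 1 * c 1 - 1"
    using eq by eventually_elim (rule sym)
  ultimately have "((\<lambda>h::real. c 1 * c 1 - 1) \<longlongrightarrow>
      0 ^ (k - 1) * (- c 1 * c k + (- c 1) ^ k * c k)) (at (0::real))"
    by (rule Lim_transform_eventually)
  then have "c 1 * c 1 - 1 = 0 ^ (k - 1) * (- c 1 * c k + (- c 1) ^ k * c k)"
    by (rule LIM_const_eq)
  then have c1: "c 1 * c 1 = 1" using k by (simp add: power_0_left)
  have "\<forall>\<^sub>F h in at 0. - c 1 * g h + (- (P h / h)) ^ k * g (- P h) = 0"
    using ev eq by eventually_elim (use c1 in auto)
  then have "((\<lambda>h::real. 0::real) \<longlongrightarrow> - c 1 * c k + (- c 1) ^ k * c k) (at (0::real))"
    by (rule Lim_transform_eventually[OF W])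
  then have "0 = - c 1 * c k + (- c 1) ^ k * c k" by (rule LIM_const_eq)
  moreover have "(- c 1) ^ k = - c 1"
    using \<open>odd k\<close> c1 by (elim oddE) (simp add: power_mult power2_eq_square)
  ultimately show False using \<open>c k \<noteq> 0\<close> c1 by auto
qed

text \<open>With \<open>P = r (2 * pi) h\<close>, shifting the solution by one period gives
  \<open>r (- (2 * pi)) P = h\<close>, and reflecting the solution through \<open>P\<close> gives
  \<open>r (2 * pi) (- P) = - r (- (2 * pi)) P\<close>. Both follow from uniqueness of small
  solutions, which is why \<open>P\<close> must be small too.\<close>

lemma return_map_reversible:
  assumes ws: "weight_system p q a b" and pq: "even p" "odd q"
    and \<delta>: "\<delta> > 0" and sol: "\<And>h. \<bar>h\<bar> < \<delta> \<Longrightarrow> polar_solution p q a b h (\<lambda>\<theta>. r \<theta> h)"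
  obtains \<eta> where "\<eta> > 0"
    "\<And>h. \<bar>h\<bar> < \<eta> \<Longrightarrow> \<bar>r (2 * pi) h\<bar> < \<eta> \<Longrightarrow> r (2 * pi) (- r (2 * pi) h) = - h"
proof -
  have p: "p > 0" using ws by (simp add: weight_system_def)
  have pi_not_neg: "\<not> pi \<le> 0" using pi_gt_zero by linarith
  let ?F = "polar_field p q a b"
  obtain \<rho> L where \<rho>: "\<rho> > 0" and L: "L \<ge> 0"
    and lip: "\<And>\<theta> u v. \<bar>u\<bar> \<le> \<rho> \<Longrightarrow> \<bar>v\<bar> \<le> \<rho> \<Longrightarrow> \<bar>?F \<theta> u - ?F \<theta> v\<bar> \<le> L * \<bar>u - v\<bar>"
    using polar_field_lipschitz[OF ws] by metis
  \<comment> \<open>Solutions exist below \<open>\<delta>\<close>; the second bound compensates the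
    exponential growth over one turn, keeping them within the Lipschitz range.\<close>
  define \<eta> where "\<eta> = min \<delta> (\<rho> / exp (L * (2 * pi)))"
  have init: "r 0 h = h" if "\<bar>h\<bar> < \<delta>" for h
    using sol[OF that] by (simp add: polar_solution_def)
  have ode: "((\<lambda>\<theta>. r \<theta> h) has_real_derivative ?F \<theta> (r \<theta> h)) (at \<theta>)"
    if "\<bar>h\<bar> < \<delta>" "\<bar>\<theta>\<bar> < 4 * pi" for h \<theta>
    using sol[OF that(1)] that(2) by (simp add: polar_solution_def polar_field_def)
  have bounded: "\<bar>r \<theta> h\<bar> \<le> \<rho>" if h: "\<bar>h\<bar> < \<eta>" and \<theta>: "\<bar>\<theta>\<bar> \<le> 2 * pi" for h \<theta>
  proof -
    have small: "\<bar>r 0 h\<bar> * exp (L * (2 * pi)) < \<rho>"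
      using h init[of h] by (simp add: \<eta>_def field_simps)
    have "\<bar>r \<theta> h\<bar> \<le> \<bar>r 0 h\<bar> * exp (L * (2 * pi))"
    proof (rule small_growth_bound[where f = "\<lambda>\<theta>. r \<theta> h" and f' = "\<lambda>\<theta>. ?F \<theta> (r \<theta> h)", OF _ _ L small \<theta>])
      show "((\<lambda>\<theta>. r \<theta> h) has_real_derivative ?F t (r t h)) (at t)" if "\<bar>t\<bar> \<le> 2 * pi" for t
      proof (rule ode)
        show "\<bar>h\<bar> < \<delta>" using h by (simp add: \<eta>_def)
        show "\<bar>t\<bar> < 4 * pi" using that pi_gt_zero by linarith
      qed
      \<comment> \<open>The field vanishes at radius 0, so the Lipschitz bound against 0 is a linear
        growth bound.\<close>
      show "\<bar>?F t (r t h)\<bar> \<le> L * \<bar>r t h\<bar>" if "\<bar>r t h\<bar> \<le> \<rho>" for t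
        using lip[OF that, of 0 t] \<rho> by (simp add: polar_field_def)
    qed
    with small show ?thesis by simp
  qed
  \<comment> \<open>The competitor \<open>s\<close> is controlled only between 0 and
    \<open>T\<close>: the shifted solution is known to be small only for angles from
    \<open>- (2 * pi)\<close> to 0.\<close>
  have unique: "s T = r T h"
    if h: "\<bar>h\<bar> < \<eta>" and T: "\<bar>T\<bar> \<le> 2 * pi" and s0: "s 0 = h"
      and s: "\<And>t. t \<in> closed_segment 0 T \<Longrightarrow> \<bar>s t\<bar> \<le> \<rho> \<and> (s has_real_derivative ?F t (s t)) (at t)"
    for s T h
  proof -
    have seg: "\<sigma> * t \<in> closed_segment 0 T" "\<bar>\<sigma> * t\<bar> \<le> 2 * pi"
      if "0 \<le> t" "t \<le> \<bar>T\<bar>" "\<sigma> = sgn T" for t \<sigma>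
      using that T by (auto simp: closed_segment_eq_real_ivl sgn_real_def)
    \<comment> \<open>Running along \<open>\<sigma> * t\<close> for
      \<open>0 \<le> t \<le> \<bar>T\<bar>\<close> lets the forward Gronwall estimate treat both
      signs of \<open>T\<close>.\<close>
    define \<sigma> where "\<sigma> = sgn T"
    have \<sigma>: "\<bar>\<sigma>\<bar> \<le> 1" "\<sigma> * \<bar>T\<bar> = T" by (auto simp: \<sigma>_def sgn_real_def)
    define w where "w t = s (\<sigma> * t) - r (\<sigma> * t) h" for t
    have "\<bar>w \<bar>T\<bar>\<bar> \<le> \<bar>w 0\<bar> * exp (L * \<bar>T\<bar>)"
    proof (rule exp_growth_bound_right)
      fix t assume t: "0 \<le> t" "t \<le> \<bar>T\<bar>"
      note st = s[OF seg(1)[OF t \<sigma>_def]]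
      have rt: "((\<lambda>\<theta>. r \<theta> h) has_real_derivative ?F (\<sigma> * t) (r (\<sigma> * t) h)) (at (\<sigma> * t))"
      proof (rule ode)
        show "\<bar>h\<bar> < \<delta>" using h by (simp add: \<eta>_def)
        show "\<bar>\<sigma> * t\<bar> < 4 * pi" using seg(2)[OF t \<sigma>_def] pi_gt_zero by linarith
      qed
      have lin: "((\<lambda>t. \<sigma> * t) has_real_derivative \<sigma>) (at t)"
        by (auto intro!: derivative_eq_intros)
      show "(w has_real_derivative
          ?F (\<sigma> * t) (s (\<sigma> * t)) * \<sigma> - ?F (\<sigma> * t) (r (\<sigma> * t) h) * \<sigma>) (at t)"
        unfolding w_def using st
        by (intro DERIV_diff DERIV_chain2[where g = "\<lambda>t. \<sigma> * t", OF _ lin]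
            DERIV_chain2[where f = "\<lambda>\<theta>. r \<theta> h" and g = "\<lambda>t. \<sigma> * t", OF rt lin]) auto
      have "\<bar>?F (\<sigma> * t) (s (\<sigma> * t)) * \<sigma> - ?F (\<sigma> * t) (r (\<sigma> * t) h) * \<sigma>\<bar> =
          \<bar>?F (\<sigma> * t) (s (\<sigma> * t)) - ?F (\<sigma> * t) (r (\<sigma> * t) h)\<bar> * \<bar>\<sigma>\<bar>"
        by (simp flip: abs_mult left_diff_distrib)
      also have "\<dots> \<le> \<bar>?F (\<sigma> * t) (s (\<sigma> * t)) - ?F (\<sigma> * t) (r (\<sigma> * t) h)\<bar>"
        using \<sigma> by (intro mult_left_le) auto
      also have "\<dots> \<le> L * \<bar>w t\<bar>"
        unfolding w_def using st bounded[OF h seg(2)[OF t \<sigma>_def]] by (intro lip) auto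
      finally show "\<bar>?F (\<sigma> * t) (s (\<sigma> * t)) * \<sigma> - ?F (\<sigma> * t) (r (\<sigma> * t) h) * \<sigma>\<bar> \<le> L * \<bar>w t\<bar>" .
    qed auto
    moreover have "w 0 = 0" using s0 init[of h] h by (simp add: w_def \<eta>_def)
    ultimately show ?thesis using \<sigma> by (simp add: w_def)
  qed
  show thesis
  proof (rule that[of \<eta>])
    show "\<eta> > 0" using \<rho> \<delta> by (simp add: \<eta>_def)
    fix h assume h: "\<bar>h\<bar> < \<eta>" and Ph: "\<bar>r (2 * pi) h\<bar> < \<eta>"
    define P where "P = r (2 * pi) h"
    have h\<delta>: "\<bar>h\<bar> < \<delta>" and P\<delta>: "\<bar>P\<bar> < \<delta>" using h Ph by (auto simp: \<eta>_def P_def)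
    \<comment> \<open>The left side is \<open>r 0 h = h\<close>, the value reached by following the
      solution back through one period.\<close>
    have "r (- (2 * pi) + 2 * pi) h = r (- (2 * pi)) P"
    proof (rule unique[where s = "\<lambda>t. r (t + 2 * pi) h"])
      fix t assume "t \<in> closed_segment 0 (- (2 * pi))"
      then have t: "- (2 * pi) \<le> t" "t \<le> 0"
        using pi_not_neg by (auto simp: closed_segment_eq_real_ivl)
      have "((\<lambda>\<theta>. r \<theta> h) has_real_derivative ?F (t + 2 * pi) (r (t + 2 * pi) h)) (at (t + 2 * pi))"
        using t pi_gt_zero by (intro ode h\<delta>) linarith
      then have "((\<lambda>t. r (t + 2 * pi) h) has_real_derivative ?F t (r (t + 2 * pi) h)) (at t)"
        by (simp add: DERIV_shift polar_field_periodic)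
      then show "\<bar>r (t + 2 * pi) h\<bar> \<le> \<rho> \<and>
          ((\<lambda>t. r (t + 2 * pi) h) has_real_derivative ?F t (r (t + 2 * pi) h)) (at t)"
        using bounded[OF h, of "t + 2 * pi"] t by auto
    qed (use Ph in \<open>auto simp: P_def\<close>)
    moreover have "- r (- (2 * pi)) P = r (2 * pi) (- P)"
    proof (rule unique[where s = "\<lambda>t. - r (- t) P"])
      fix t assume "t \<in> closed_segment 0 (2 * pi)"
      then have t: "0 \<le> t" "t \<le> 2 * pi"
        using pi_not_neg by (auto simp: closed_segment_eq_real_ivl)
      have t4: "\<bar>- t\<bar> < 4 * pi" using t pi_gt_zero by linarith
      have "((\<lambda>t. - r (- t) P) has_real_derivative - (?F (- t) (r (- t) P) * (- 1))) (at t)"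
        using ode[OF P\<delta> t4] by (auto simp: DERIV_mirror intro!: derivative_eq_intros)
      moreover have "summable (\<lambda>k. R_coeff p q a b k (- t) * r (- t) P ^ k)"
        using sol[OF P\<delta>] t4 by (simp add: polar_solution_def)
      from polar_field_minus[OF p pq this] have "?F (- t) (r (- t) P) = ?F t (- r (- t) P)" by simp
      ultimately show "\<bar>- r (- t) P\<bar> \<le> \<rho> \<and>
          ((\<lambda>t. - r (- t) P) has_real_derivative ?F t (- r (- t) P)) (at t)"
        using bounded[of P "- t"] Ph t by (auto simp: P_def)
    qed (use Ph init[OF P\<delta>] in \<open>auto simp: P_def\<close>)
    ultimately show "r (2 * pi) (- r (2 * pi) h) = - h"
      using init[OF h\<delta>] by (simp add: P_def)
  qed
qed

theorem theorem3p3: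
  fixes p q :: nat
    and a b :: "nat \<Rightarrow> nat \<Rightarrow> real"
    and r :: "real \<Rightarrow> real \<Rightarrow> real"
    and \<nu> :: "nat \<Rightarrow> real \<Rightarrow> real"
    and k :: nat
  assumes "weight_system p q a b"
    and "solution_expansion p q a b r \<nu>"
    and "even p"
    and "odd q"
    and "k > 1"
    and "\<nu> k (2 * pi) \<noteq> 0"
    and "\<And>j. 1 < j \<Longrightarrow> j < k \<Longrightarrow> \<nu> j (2 * pi) = 0"
  shows "even k"
proof -
  obtain \<delta> where \<delta>: "\<delta> > 0" "\<And>h. \<bar>h\<bar> < \<delta> \<Longrightarrow> polar_solution p q a b h (\<lambda>\<theta>. r \<theta> h)"
    using assms(2) unfolding solution_expansion_def by blast
  have "\<bar>2 * pi\<bar> < 4 * pi" using pi_gt_zero by linarith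
  then obtain \<epsilon> where \<epsilon>: "\<epsilon> > 0"
    "\<And>h. \<bar>h\<bar> < \<epsilon> \<Longrightarrow> (\<lambda>k. \<nu> (Suc k) (2 * pi) * h ^ Suc k) sums r (2 * pi) h"
    using assms(2) unfolding solution_expansion_def by blast
  obtain \<eta> where \<eta>: "\<eta> > 0"
    "\<And>h. \<bar>h\<bar> < \<eta> \<Longrightarrow> \<bar>r (2 * pi) h\<bar> < \<eta> \<Longrightarrow> r (2 * pi) (- r (2 * pi) h) = - h"
    using return_map_reversible[OF assms(1,3,4) \<delta>] by metis
  show ?thesis
  proof (rule involutive_powser_leading_coeff[of "min \<epsilon> \<eta>" "\<lambda>n. \<nu> n (2 * pi)" "r (2 * pi)"])
    show "(\<lambda>n. \<nu> (Suc n) (2 * pi) * h ^ Suc n) sums r (2 * pi) h" if "\<bar>h\<bar> < min \<epsilon> \<eta>" for h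
      using \<epsilon>(2)[of h] that by simp
    show "r (2 * pi) (- r (2 * pi) h) = - h" if "\<bar>h\<bar> < min \<epsilon> \<eta>" "\<bar>r (2 * pi) h\<bar> < min \<epsilon> \<eta>" for h
      using \<eta>(2)[of h] that by simp
  qed (use \<epsilon> \<eta> assms in auto)
qed

end
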